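(* Let $\Omega\subset\mathbb{R}^n$ be a bounded domain, $p\in(1,\infty)$, $\theta\in(0,\infty)$, $\sigma\in(\theta,\infty)$, and let $\mathfrak{B}\in C^0(\overline\Omega;\mathbb{R}^n)$, $\varrho\in C^0(\overline\Omega)$ and $\mathfrak{c}\in C^0(\overline\Omega)$ with $\mathfrak{c}\le0$. Suppose that $v\in C^{0,1}_{\rm loc}(\Omega)$ is a non-negative viscosity supersolution of $$|\nabla v|^{\theta}\Delta_p^{\mathrm N}v+\langle\mathfrak{B}(x),\nabla v\rangle|\nabla v|^\theta+\varrho(x)|\nabla v|^\sigma+\mathfrak{c}(x)v^{1+\theta}=0\quad\text{in }\Omega.$$ In the sublinear case $\theta<\sigma<1+\theta$, assume in addition that $\varrho\ge0$. Then either $v\equiv0$ in $\Omega$ or $v>0$ in $\Omega$. Furthermore, if $\Omega$ satisfies the interior sphere condition and $v(x)>v(z)=0$ for all $x\in\Omega$ and some $z\in\partial\Omega$, then there exists a constant $\nu>0$ such that $$v(x)\ge\nu\,(r-|x-x_0|)\quad\text{for }x\in B_r(x_0),$$ where $B_r(x_0)\subset\Omega$ is a ball tangent to $\partial\Omega$ at $z$.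
   Context: $B_r(x_0)$ is the open ball of radius $r$ centered at $x_0\in\mathbb{R}^n$. The normalized $p$-Laplacian is $\Delta_p^{\mathrm N}u=\Delta u+(p-2)\left\langle D^2u\frac{\nabla u}{|\nabla u|},\frac{\nabla u}{|\nabla u|}\right\rangle$. Write $H(\xi,x)=\langle\mathfrak{B}(x),\xi\rangle|\xi|^\theta+\varrho(x)|\xi|^\sigma$. For a symmetric matrix $X$, $\lambda_{\max}(X)$ and $\lambda_{\min}(X)$ denote its largest and smallest eigenvalues. The condition $v(z)=0$ at the boundary point $z$ refers to the continuous extension of $v$ to $z$. Viscosity supersolutions: write the equation as $|\nabla v|^\theta\Delta_p^{\mathrm N}v+H(\nabla v,x)=f_0(x,v)$ with $f_0(x,s)=-\mathfrak{c}(x)s^{1+\theta}$. A continuous function $v$ is a viscosity supersolution in $\Omega$ if, whenever $\phi\in C^2(\Omega)$ and $v-\phi$ has a local minimum at $x_0\in\Omega$ with $\phi(x_0)=v(x_0)$: (1) if $\nabla\phi(x_0)\neq0$, then $|\nabla\phi(x_0)|^\theta\Delta_p^{\mathrm N}\phi(x_0)+H(\nabla\phi(x_0),x_0)\le f_0(x_0,\phi(x_0))$; (2) if $\nabla\phi(x_0)=0$ and $p\ge2$, then $\Delta\phi(x_0)+(p-2)\lambda_{\min}(D^2\phi(x_0))\le f_0(x_0,\phi(x_0))$; (3) if $\nabla\phi(x_0)=0$ and $1<p<2$, then $\Delta\phi(x_0)+(p-2)\lambda_{\max}(D^2\phi(x_0))\le f_0(x_0,\phi(x_0))$. *)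

theory Defs
  imports "HOL-Analysis.Analysis"
begin

definition grad :: "(real^'n \<Rightarrow> real) \<Rightarrow> real^'n \<Rightarrow> real^'n" where
  "grad f x = (\<chi> i. frechet_derivative f (at x) (axis i 1))"

definition hessian :: "(real^'n \<Rightarrow> real) \<Rightarrow> real^'n \<Rightarrow> real^'n^'n" where
  "hessian f x = jacobian (grad f) (at x)"

text \<open>The class \<open>C\<^sup>2(\<Omega>)\<close>, for open \<open>\<Omega>\<close>; since \<open>\<Omega>\<close> is open, the derivatives at points of \<open>\<Omega>\<close>
  do not depend on the values of the (total) function outside \<open>\<Omega>\<close>.\<close>

definition C2_on :: "(real^'n) set \<Rightarrow> (real^'n \<Rightarrow> real) \<Rightarrow> bool" where
  "C2_on \<Omega> f \<longleftrightarrow>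
     (\<forall>x\<in>\<Omega>. f differentiable (at x)) \<and>
     (\<forall>x\<in>\<Omega>. grad f differentiable (at x)) \<and>
     continuous_on \<Omega> (hessian f)"

definition laplacian :: "(real^'n \<Rightarrow> real) \<Rightarrow> real^'n \<Rightarrow> real" where
  "laplacian f x = trace (hessian f x)"

definition normalized_p_laplacian :: "real \<Rightarrow> (real^'n \<Rightarrow> real) \<Rightarrow> real^'n \<Rightarrow> real" where
  "normalized_p_laplacian p f x =
     (let e = grad f x /\<^sub>R norm (grad f x)
      in laplacian f x + (p - 2) * ((hessian f x *v e) \<bullet> e))"

definition eigenvalues :: "real^'n^'n \<Rightarrow> real set" where
  "eigenvalues X = {l. \<exists>w. w \<noteq> 0 \<and> X *v w = l *\<^sub>R w}"

definition lambda_max :: "real^'n^'n \<Rightarrow> real" where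
  "lambda_max X = Max (eigenvalues X)"

definition lambda_min :: "real^'n^'n \<Rightarrow> real" where
  "lambda_min X = Min (eigenvalues X)"

definition first_order_term ::
  "real \<Rightarrow> real \<Rightarrow> (real^'n \<Rightarrow> real^'n) \<Rightarrow> (real^'n \<Rightarrow> real) \<Rightarrow> real^'n \<Rightarrow> real^'n \<Rightarrow> real" where
  "first_order_term \<theta> \<sigma> B \<rho> \<xi> x = (B x \<bullet> \<xi>) * norm \<xi> powr \<theta> + \<rho> x * norm \<xi> powr \<sigma>"

definition zero_order_rhs :: "real \<Rightarrow> (real^'n \<Rightarrow> real) \<Rightarrow> real^'n \<Rightarrow> real \<Rightarrow> real" where
  "zero_order_rhs \<theta> c x s = - c x * s powr (1 + \<theta>)"

text \<open>Viscosity supersolutions in an open set \<open>\<Omega>\<close> of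
  \<open>|\<nabla>v|\<^sup>\<theta> \<Delta>\<^sub>p\<^sup>N v + \<langle>B(x), \<nabla>v\<rangle> |\<nabla>v|\<^sup>\<theta> + \<rho>(x) |\<nabla>v|\<^sup>\<sigma> + c(x) v\<^sup>1\<^sup>+\<^sup>\<theta> = 0\<close>.
  Where the gradient of the test function vanishes, the inequality carries no factor
  \<open>|\<nabla>\<phi>|\<^sup>\<theta>\<close>. The definition is meant for non-negative \<open>v\<close>, because of the power \<open>v\<^sup>1\<^sup>+\<^sup>\<theta>\<close>.\<close>

definition viscosity_supersolution ::
  "real \<Rightarrow> real \<Rightarrow> real \<Rightarrow> (real^'n \<Rightarrow> real^'n) \<Rightarrow> (real^'n \<Rightarrow> real) \<Rightarrow> (real^'n \<Rightarrow> real) \<Rightarrow>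
    (real^'n) set \<Rightarrow> (real^'n \<Rightarrow> real) \<Rightarrow> bool" where
  "viscosity_supersolution p \<theta> \<sigma> B \<rho> c \<Omega> v \<longleftrightarrow>
     continuous_on \<Omega> v \<and>
     (\<forall>\<phi> x0. C2_on \<Omega> \<phi> \<and> x0 \<in> \<Omega> \<and> \<phi> x0 = v x0 \<and>
        (\<forall>\<^sub>F x in at x0 within \<Omega>. v x0 - \<phi> x0 \<le> v x - \<phi> x) \<longrightarrow>
          (grad \<phi> x0 \<noteq> 0 \<longrightarrow>
             norm (grad \<phi> x0) powr \<theta> * normalized_p_laplacian p \<phi> x0
               + first_order_term \<theta> \<sigma> B \<rho> (grad \<phi> x0) x0
             \<le> zero_order_rhs \<theta> c x0 (\<phi> x0)) \<and>
          (grad \<phi> x0 = 0 \<and> p \<ge> 2 \<longrightarrow>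
             laplacian \<phi> x0 + (p - 2) * lambda_min (hessian \<phi> x0)
             \<le> zero_order_rhs \<theta> c x0 (\<phi> x0)) \<and>
          (grad \<phi> x0 = 0 \<and> 1 < p \<and> p < 2 \<longrightarrow>
             laplacian \<phi> x0 + (p - 2) * lambda_max (hessian \<phi> x0)
             \<le> zero_order_rhs \<theta> c x0 (\<phi> x0)))"

text \<open>The class \<open>C\<^sup>0\<^sup>,\<^sup>1\<close> locally in an open set.\<close>

definition locally_Lipschitz_in :: "(real^'n) set \<Rightarrow> (real^'n \<Rightarrow> real) \<Rightarrow> bool" where
  "locally_Lipschitz_in \<Omega> v \<longleftrightarrow> (\<forall>K. compact K \<and> K \<subseteq> \<Omega> \<longrightarrow> (\<exists>L. L-lipschitz_on K v))"

definition interior_tangent_ball :: "(real^'n) set \<Rightarrow> real^'n \<Rightarrow> real^'n \<Rightarrow> real \<Rightarrow> bool" where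
  "interior_tangent_ball \<Omega> z x0 r \<longleftrightarrow> r > 0 \<and> ball x0 r \<subseteq> \<Omega> \<and> z \<in> frontier \<Omega> \<inter> sphere x0 r"

definition interior_sphere_condition :: "(real^'n) set \<Rightarrow> bool" where
  "interior_sphere_condition \<Omega> \<longleftrightarrow> (\<forall>z\<in>frontier \<Omega>. \<exists>x0 r. interior_tangent_ball \<Omega> z x0 r)"

end

theory Submission
  imports Defs
begin

text \<open>
  Both assertions follow from Hopf's barrier \<open>w(x) = \<epsilon> (exp (-\<alpha> |x - x0|\<^sup>2) - exp (-\<alpha> R\<^sup>2))\<close>.
  Fix an annulus \<open>a \<le> |x - x0| \<le> R\<close> with \<open>a > 0\<close> and put \<open>E = \<epsilon> exp (-\<alpha> |x - x0|\<^sup>2)\<close>,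
  \<open>t = 2 \<alpha> |x - x0|\<close>. Then \<open>|\<nabla>w| = t E > 0\<close>, and the second order and drift terms of the
  operator, applied to \<open>w\<close>, add up to \<open>(t E)\<^sup>1\<^sup>+\<^sup>\<theta>\<close> times \<open>(p - 1) t + O(1)\<close>, with a bound
  independent of \<open>\<alpha>\<close> and \<open>\<epsilon>\<close>. The term \<open>\<rho> |\<nabla>w|\<^sup>\<sigma>\<close> is non-negative if
  \<open>\<sigma> < 1 + \<theta>\<close>, and otherwise at most \<open>sup |\<rho>| (t E)\<^sup>1\<^sup>+\<^sup>\<theta>\<close> in absolute value once
  \<open>t E \<le> 1\<close>. So if \<open>\<alpha>\<close> is large and then \<open>\<epsilon>\<close> is small, the sum of these three terms exceeds
  \<open>sup |c| E\<^sup>1\<^sup>+\<^sup>\<theta>\<close> (lemma \<open>gauss_barrier_strict_subsolution\<close>). Hence no translate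
  \<open>w + const\<close> can touch \<open>v\<close> from below at a point of the annulus where \<open>v \<le> E\<close>
  (lemma \<open>supersolution_untouched\<close>). At a negative minimum of \<open>v - w\<close> one has
  \<open>v < w < E\<close>, so \<open>w \<le> v\<close> on the annulus as soon as this holds on the inner sphere
  (lemma \<open>gauss_barrier_comparison\<close>).

  Strong maximum principle: if \<open>v\<close> vanishes somewhere but not everywhere, some ball, whose
  closure is contained in the domain, has \<open>v > 0\<close> inside and \<open>v z = 0\<close> at a boundary point
  \<open>z\<close> (lemma \<open>ball_touching_zero_set\<close>). By comparison \<open>w \<le> v\<close> inside the ball, and outside
  it \<open>w \<le> 0 \<le> v\<close>; since \<open>w z = 0 = v z\<close>, the barrier touches \<open>v\<close> from below at \<open>z\<close>, which
  was excluded.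

  Boundary estimate: comparison is applied on concentric balls of radius \<open>s < r\<close> with constants
  independent of \<open>s\<close>. Letting \<open>s\<close> tend to \<open>r\<close> gives
  \<open>v \<ge> \<epsilon> (exp (-\<alpha> |x - x0|\<^sup>2) - exp (-\<alpha> r\<^sup>2))\<close> for \<open>r/2 \<le> |x - x0| < r\<close>, and the right-hand
  side dominates a multiple of \<open>r - |x - x0|\<close>. On the inner half ball \<open>v\<close> has a positive minimum.

  As the gradient of the barrier does not vanish on the annulus, only the first clause of the
  definition of a supersolution is used.
\<close>

section \<open>Derivatives of the Gaussian barrier\<close>

text \<open>Hopf's barrier centred at \<open>x0\<close>, with a free additive constant \<open>k\<close>, so that its vertical
  translates are of the same form.\<close>

definition gauss_barrier :: "real^'n \<Rightarrow> real \<Rightarrow> real \<Rightarrow> real \<Rightarrow> real^'n \<Rightarrow> real" where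
  "gauss_barrier x0 \<alpha> \<epsilon> k x = \<epsilon> * exp (- \<alpha> * (norm (x - x0))\<^sup>2) + k"

lemma gauss_barrier_has_derivative:
  "(gauss_barrier x0 \<alpha> \<epsilon> k has_derivative
     (\<lambda>h. - 2 * \<alpha> * (\<epsilon> * exp (- \<alpha> * (norm (x - x0))\<^sup>2)) * ((x - x0) \<bullet> h))) (at x)"
  unfolding gauss_barrier_def power2_norm_eq_inner
  by (auto intro!: derivative_eq_intros simp: inner_commute algebra_simps)

lemma grad_gauss_barrier:
  "grad (gauss_barrier x0 \<alpha> \<epsilon> k) x
     = (- 2 * \<alpha> * (\<epsilon> * exp (- \<alpha> * (norm (x - x0))\<^sup>2))) *\<^sub>R (x - x0)"
  unfolding grad_def frechet_derivative_at[OF gauss_barrier_has_derivative, symmetric]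
  by (simp add: vec_eq_iff inner_axis)

lemma grad_gauss_barrier_has_derivative:
  "(grad (gauss_barrier x0 \<alpha> \<epsilon> k) has_derivative
     (\<lambda>h. (\<epsilon> * exp (- \<alpha> * (norm (x - x0))\<^sup>2)) *\<^sub>R
            ((4 * \<alpha>\<^sup>2 * ((x - x0) \<bullet> h)) *\<^sub>R (x - x0) - (2 * \<alpha>) *\<^sub>R h))) (at x)"
proof -
  define e where "e = (\<lambda>x. - 2 * \<alpha> * (\<epsilon> * exp (- \<alpha> * (norm (x - x0))\<^sup>2)))"
  have e: "(e has_derivative (\<lambda>h. (\<epsilon> * exp (- \<alpha> * (norm (x - x0))\<^sup>2)) * (4 * \<alpha>\<^sup>2 * ((x - x0) \<bullet> h)))) (at x)"
    unfolding e_def power2_norm_eq_inner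
    by (auto intro!: derivative_eq_intros simp: inner_commute power2_eq_square)
  have "((\<lambda>x. e x *\<^sub>R (x - x0)) has_derivative (\<lambda>h. e x *\<^sub>R (h - 0)
     + ((\<epsilon> * exp (- \<alpha> * (norm (x - x0))\<^sup>2)) * (4 * \<alpha>\<^sup>2 * ((x - x0) \<bullet> h))) *\<^sub>R (x - x0))) (at x)"
    by (intro has_derivative_scaleR e has_derivative_diff has_derivative_ident has_derivative_const)
  moreover have "(\<lambda>h. e x *\<^sub>R (h - 0)
     + ((\<epsilon> * exp (- \<alpha> * (norm (x - x0))\<^sup>2)) * (4 * \<alpha>\<^sup>2 * ((x - x0) \<bullet> h))) *\<^sub>R (x - x0))
     = (\<lambda>h. (\<epsilon> * exp (- \<alpha> * (norm (x - x0))\<^sup>2)) *\<^sub>R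
            ((4 * \<alpha>\<^sup>2 * ((x - x0) \<bullet> h)) *\<^sub>R (x - x0) - (2 * \<alpha>) *\<^sub>R h))"
    unfolding e_def by (rule ext) (simp only: vec_eq_iff, simp add: algebra_simps)
  ultimately show ?thesis
    unfolding grad_gauss_barrier[abs_def] e_def by (simp only:)
qed

lemma hessian_gauss_barrier:
  "hessian (gauss_barrier x0 \<alpha> \<epsilon> k) x
     = matrix (\<lambda>h. (\<epsilon> * exp (- \<alpha> * (norm (x - x0))\<^sup>2)) *\<^sub>R
            ((4 * \<alpha>\<^sup>2 * ((x - x0) \<bullet> h)) *\<^sub>R (x - x0) - (2 * \<alpha>) *\<^sub>R h))"
  unfolding hessian_def jacobian_def
    frechet_derivative_at[OF grad_gauss_barrier_has_derivative, symmetric] ..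

lemma hessian_gauss_barrier_mult:
  "hessian (gauss_barrier x0 \<alpha> \<epsilon> k) x *v h
     = (\<epsilon> * exp (- \<alpha> * (norm (x - x0))\<^sup>2)) *\<^sub>R
            ((4 * \<alpha>\<^sup>2 * ((x - x0) \<bullet> h)) *\<^sub>R (x - x0) - (2 * \<alpha>) *\<^sub>R h)"
  unfolding hessian_gauss_barrier
  by (rule matrix_works) (rule has_derivative_linear[OF grad_gauss_barrier_has_derivative,
      unfolded linear_matrix_vector_mul_eq[symmetric]])

lemma laplacian_gauss_barrier:
  fixes x0 x :: "real^'n"
  shows "laplacian (gauss_barrier x0 \<alpha> \<epsilon> k) x
     = (\<epsilon> * exp (- \<alpha> * (norm (x - x0))\<^sup>2)) *
         (4 * \<alpha>\<^sup>2 * (norm (x - x0))\<^sup>2 - 2 * \<alpha> * real CARD('n))"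
proof -
  have "(\<Sum>i\<in>UNIV. (x$i - x0$i) * (x$i - x0$i)) = (norm (x - x0))\<^sup>2"
    by (simp add: power2_norm_eq_inner inner_vec_def)
  then show ?thesis
    unfolding laplacian_def hessian_gauss_barrier trace_def matrix_def
    by (simp add: inner_axis sum_distrib_left[symmetric] sum_subtractf mult.assoc)
qed

lemma C2_on_gauss_barrier: "C2_on \<Omega> (gauss_barrier x0 \<alpha> \<epsilon> k)"
  unfolding C2_on_def
proof (intro conjI ballI)
  show "gauss_barrier x0 \<alpha> \<epsilon> k differentiable at x" for x
    using gauss_barrier_has_derivative by (rule differentiableI)
  show "grad (gauss_barrier x0 \<alpha> \<epsilon> k) differentiable at x" for x
    using grad_gauss_barrier_has_derivative by (rule differentiableI)
  show "continuous_on \<Omega> (hessian (gauss_barrier x0 \<alpha> \<epsilon> k))"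
    unfolding hessian_gauss_barrier[abs_def] matrix_def
    by (intro continuous_on_vec_lambda) (auto intro!: continuous_intros)
qed

lemma normalized_p_laplacian_gauss_barrier:
  fixes x0 x :: "real^'n"
  assumes "x \<noteq> x0" "\<alpha> > 0" "\<epsilon> > 0"
  shows "normalized_p_laplacian p (gauss_barrier x0 \<alpha> \<epsilon> k) x
     = (\<epsilon> * exp (- \<alpha> * (norm (x - x0))\<^sup>2)) *
         ((p - 1) * (2 * \<alpha> * norm (x - x0))\<^sup>2 - 2 * \<alpha> * (real CARD('n) + p - 2))"
proof -
  define E where "E = \<epsilon> * exp (- \<alpha> * (norm (x - x0))\<^sup>2)"
  define e where "e = grad (gauss_barrier x0 \<alpha> \<epsilon> k) x /\<^sub>R norm (grad (gauss_barrier x0 \<alpha> \<epsilon> k) x)"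
  have "E > 0" using assms by (simp add: E_def)
  have d: "norm (x - x0) > 0" using assms by simp
  have e: "e = (- inverse (norm (x - x0))) *\<^sub>R (x - x0)"
    unfolding e_def grad_gauss_barrier E_def[symmetric]
    using \<open>E > 0\<close> assms(2) by (simp add: abs_mult divide_simps)
  have ee: "e \<bullet> e = 1"
    unfolding e using d by (simp add: power2_norm_eq_inner[symmetric] power2_eq_square)
  have ye: "(x - x0) \<bullet> e = - norm (x - x0)"
    unfolding e inner_scaleR_right power2_norm_eq_inner[symmetric] using d
    by (simp add: power2_eq_square)
  have "(hessian (gauss_barrier x0 \<alpha> \<epsilon> k) x *v e) \<bullet> e
      = E * (4 * \<alpha>\<^sup>2 * ((x - x0) \<bullet> e) * ((x - x0) \<bullet> e) - 2 * \<alpha> * (e \<bullet> e))"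
    unfolding hessian_gauss_barrier_mult E_def[symmetric]
    by (simp only: inner_scaleR_left inner_diff_left)
  also have "\<dots> = E * (4 * \<alpha>\<^sup>2 * (norm (x - x0))\<^sup>2 - 2 * \<alpha>)"
    unfolding ee ye by (simp add: power2_eq_square)
  finally have hess: "(hessian (gauss_barrier x0 \<alpha> \<epsilon> k) x *v e) \<bullet> e
      = E * (4 * \<alpha>\<^sup>2 * (norm (x - x0))\<^sup>2 - 2 * \<alpha>)" .
  show ?thesis
    unfolding normalized_p_laplacian_def Let_def e_def[symmetric] laplacian_gauss_barrier
      E_def[symmetric] hess
    by (simp add: algebra_simps power2_eq_square)
qed

section \<open>The barrier is a strict subsolution on an annulus\<close>

text \<open>The constants \<open>\<alpha>\<close> and \<open>\<epsilon>0\<close> depend on the coefficients only through the bound \<open>M\<close>. On the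
  left, \<open>M\<close> stands for the bound of the zero order coefficient.\<close>

lemma gauss_barrier_strict_subsolution:
  fixes x0 :: "real^'n" and p \<theta> \<sigma> M a R :: real
  assumes "p > 1" "\<theta> > 0" "\<sigma> > \<theta>" "M \<ge> 0" "0 < a" "a \<le> R"
  obtains \<alpha> \<epsilon>0 where "\<alpha> > 0" "\<epsilon>0 > 0"
    and "\<And>B \<rho> \<epsilon> k x. \<lbrakk>0 < \<epsilon>; \<epsilon> \<le> \<epsilon>0; a \<le> norm (x - x0); norm (x - x0) \<le> R;
           norm (B x) \<le> M; \<bar>\<rho> x\<bar> \<le> M; \<sigma> < 1 + \<theta> \<longrightarrow> \<rho> x \<ge> 0\<rbrakk> \<Longrightarrow>
         M * (\<epsilon> * exp (- \<alpha> * (norm (x - x0))\<^sup>2)) powr (1 + \<theta>)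
         < norm (grad (gauss_barrier x0 \<alpha> \<epsilon> k) x) powr \<theta>
             * normalized_p_laplacian p (gauss_barrier x0 \<alpha> \<epsilon> k) x
           + first_order_term \<theta> \<sigma> B \<rho> (grad (gauss_barrier x0 \<alpha> \<epsilon> k) x) x"
proof -
  define n where "n = real CARD('n)"
  define N where "N = (n + p - 2) / a + M"
  have "n \<ge> 1" unfolding n_def by (simp add: Suc_leI)
  then have np: "n + p - 2 \<ge> 0" using assms by simp
  then have "N \<ge> 0" unfolding N_def using assms by simp
  \<comment> \<open>\<open>T\<close> is a lower bound for \<open>t = 2 \<alpha> |x - x0|\<close> that makes \<open>(p - 1) t\<close> beat all other terms;
    \<open>\<epsilon>0\<close> is chosen such that the gradient of the barrier has norm at most 1.\<close>
  define T where "T = 1 + (N + 2 * M + 1) / (p - 1)"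
  have "T \<ge> 1" unfolding T_def using assms \<open>N \<ge> 0\<close> by simp
  have pT: "(p - 1) * T \<ge> N + 2 * M + 1"
    unfolding T_def distrib_left using assms by simp
  define \<alpha> where "\<alpha> = T / (2 * a)"
  define \<epsilon>0 where "\<epsilon>0 = 1 / (2 * \<alpha> * R)"
  have "\<alpha> > 0" unfolding \<alpha>_def using assms \<open>T \<ge> 1\<close> by simp
  have "\<epsilon>0 > 0" unfolding \<epsilon>0_def using assms \<open>\<alpha> > 0\<close> by simp
  have main: "M * (\<epsilon> * exp (- \<alpha> * (norm (x - x0))\<^sup>2)) powr (1 + \<theta>)
         < norm (grad (gauss_barrier x0 \<alpha> \<epsilon> k) x) powr \<theta>
             * normalized_p_laplacian p (gauss_barrier x0 \<alpha> \<epsilon> k) x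
           + first_order_term \<theta> \<sigma> B \<rho> (grad (gauss_barrier x0 \<alpha> \<epsilon> k) x) x"
    if \<epsilon>: "0 < \<epsilon>" "\<epsilon> \<le> \<epsilon>0" and x: "a \<le> norm (x - x0)" "norm (x - x0) \<le> R"
      and BM: "norm (B x) \<le> M" and rM: "\<bar>\<rho> x\<bar> \<le> M" and r0: "\<sigma> < 1 + \<theta> \<longrightarrow> \<rho> x \<ge> 0"
    for B :: "real^'n \<Rightarrow> real^'n" and \<rho> \<epsilon> k x
  proof -
    define E where "E = \<epsilon> * exp (- \<alpha> * (norm (x - x0))\<^sup>2)"
    define t where "t = 2 * \<alpha> * norm (x - x0)"
    define g where "g = grad (gauss_barrier x0 \<alpha> \<epsilon> k) x"
    have "E > 0" using \<epsilon> by (simp add: E_def)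
    have "E \<le> \<epsilon>0"
    proof -
      have "exp (- \<alpha> * (norm (x - x0))\<^sup>2) \<le> 1" using \<open>\<alpha> > 0\<close> by simp
      then have "E \<le> \<epsilon> * 1" unfolding E_def using \<epsilon> by (intro mult_left_mono) auto
      then show ?thesis using \<epsilon> by simp
    qed
    have "x \<noteq> x0" using x assms by auto
    have "T = 2 * \<alpha> * a" unfolding \<alpha>_def using assms by simp
    also have "\<dots> \<le> t" unfolding t_def using x \<open>\<alpha> > 0\<close> by simp
    finally have "T \<le> t" .
    then have "t \<ge> 1" using \<open>T \<ge> 1\<close> by simp
    have "t * E \<le> (2 * \<alpha> * R) * \<epsilon>0"
      unfolding t_def using \<open>\<alpha> > 0\<close> x \<open>E \<le> \<epsilon>0\<close> \<open>E > 0\<close> assms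
      by (intro mult_mono) auto
    also have "\<dots> = 1" unfolding \<epsilon>0_def using \<open>\<alpha> > 0\<close> assms by simp
    finally have tE1: "t * E \<le> 1" .
    have tE0: "t * E > 0" using \<open>t \<ge> 1\<close> \<open>E > 0\<close> by simp
    have g: "norm g = t * E"
      unfolding g_def grad_gauss_barrier E_def[symmetric] t_def using \<open>E > 0\<close> \<open>\<alpha> > 0\<close>
      by (simp add: abs_mult)
    have lap: "normalized_p_laplacian p (gauss_barrier x0 \<alpha> \<epsilon> k) x
        = E * ((p - 1) * t\<^sup>2 - 2 * \<alpha> * (n + p - 2))"
      using normalized_p_laplacian_gauss_barrier[OF \<open>x \<noteq> x0\<close> \<open>\<alpha> > 0\<close> \<open>0 < \<epsilon>\<close>, of p k]
      unfolding E_def t_def n_def by simp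
    have "2 * \<alpha> * (n + p - 2) \<le> (t / a) * (n + p - 2)"
      unfolding t_def using x np \<open>\<alpha> > 0\<close> assms(5) by (intro mult_right_mono) (auto simp: field_simps)
    moreover have "t * ((p - 1) * t - (n + p - 2) / a) = (p - 1) * t\<^sup>2 - (t / a) * (n + p - 2)"
      using assms(5) by (simp add: field_simps power2_eq_square)
    ultimately have "(p - 1) * t\<^sup>2 - 2 * \<alpha> * (n + p - 2) \<ge> t * ((p - 1) * t - (n + p - 2) / a)"
      by (metis diff_left_mono)
    then have lap_ge: "normalized_p_laplacian p (gauss_barrier x0 \<alpha> \<epsilon> k) x
        \<ge> (t * E) * ((p - 1) * t - (n + p - 2) / a)"
      unfolding lap using \<open>E > 0\<close> by (simp add: mult.assoc mult.left_commute[of t])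
    have "\<bar>B x \<bullet> g\<bar> \<le> norm (B x) * norm g" by (rule Cauchy_Schwarz_ineq2)
    also have "\<dots> \<le> M * (t * E)" unfolding g using BM tE0 by (intro mult_right_mono) auto
    finally have Bg: "B x \<bullet> g \<ge> - M * (t * E)" by simp
    have rho: "\<rho> x * (t * E) powr \<sigma> \<ge> - M * (t * E) powr (1 + \<theta>)"
    proof (cases "\<sigma> < 1 + \<theta>")
      case True
      then have "0 \<le> \<rho> x * (t * E) powr \<sigma>" using r0 by simp
      moreover have "- M * (t * E) powr (1 + \<theta>) \<le> 0" using assms by simp
      ultimately show ?thesis by linarith
    next
      case False
      then have "(t * E) powr \<sigma> \<le> (t * E) powr (1 + \<theta>)"
        using tE0 tE1 by (intro powr_mono') auto
      then have "\<bar>\<rho> x\<bar> * (t * E) powr \<sigma> \<le> M * (t * E) powr (1 + \<theta>)"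
        using rM by (intro mult_mono) auto
      moreover have "\<rho> x * (t * E) powr \<sigma> \<ge> - (\<bar>\<rho> x\<bar> * (t * E) powr \<sigma>)"
        using mult_right_mono[of "- \<bar>\<rho> x\<bar>" "\<rho> x" "(t * E) powr \<sigma>"] by simp
      ultimately show ?thesis by linarith
    qed
    have split: "(t * E) powr \<theta> * (t * E) = (t * E) powr (1 + \<theta>)"
      using tE0 by (simp add: powr_add)
    have "(p - 1) * T \<le> (p - 1) * t" using \<open>T \<le> t\<close> assms by simp
    then have key: "M + 1 \<le> (p - 1) * t - (n + p - 2) / a - M - M"
      using pT unfolding N_def by linarith
    have "M * E powr (1 + \<theta>) < (M + 1) * E powr (1 + \<theta>)"
      using \<open>E > 0\<close> by simp
    also have "\<dots> \<le> (M + 1) * (t * E) powr (1 + \<theta>)"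
      using \<open>t \<ge> 1\<close> \<open>E > 0\<close> assms by (intro mult_left_mono powr_mono2) auto
    also have "\<dots> \<le> ((p - 1) * t - (n + p - 2) / a - M - M) * (t * E) powr (1 + \<theta>)"
      using key by (intro mult_right_mono) auto
    also have "\<dots> = (t * E) powr \<theta> * ((t * E) * ((p - 1) * t - (n + p - 2) / a))
        + (- M * (t * E)) * (t * E) powr \<theta> + - M * (t * E) powr (1 + \<theta>)"
      unfolding split[symmetric] by (simp add: algebra_simps)
    also have "\<dots> \<le> (t * E) powr \<theta> * normalized_p_laplacian p (gauss_barrier x0 \<alpha> \<epsilon> k) x
        + (B x \<bullet> g) * (t * E) powr \<theta> + \<rho> x * (t * E) powr \<sigma>"
      using lap_ge Bg rho by (intro add_mono mult_left_mono mult_right_mono) auto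
    finally show ?thesis
      unfolding first_order_term_def g_def[symmetric] g E_def[symmetric] by simp
  qed
  show ?thesis
    using that[OF \<open>\<alpha> > 0\<close> \<open>\<epsilon>0 > 0\<close>] main by blast
qed

section \<open>Comparison with supersolutions\<close>

text \<open>No vertical translate of the barrier touches \<open>v\<close> from below at a point of the annulus
  \<open>a \<le> |x - x0| \<le> R\<close> where \<open>v\<close> is at most the Gaussian. For a supersolution, the bound on
  \<open>v\<close> is what controls its zero order term.\<close>

definition untouched ::
  "(real^'n) set \<Rightarrow> (real^'n \<Rightarrow> real) \<Rightarrow> real^'n \<Rightarrow> real \<Rightarrow> real \<Rightarrow> real \<Rightarrow> real \<Rightarrow> bool" where
  "untouched \<Omega> v x0 a R \<alpha> \<epsilon> \<longleftrightarrow>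
     (\<forall>k. \<forall>x1\<in>\<Omega>. a \<le> norm (x1 - x0) \<and> norm (x1 - x0) \<le> R \<and>
        v x1 \<le> \<epsilon> * exp (- \<alpha> * (norm (x1 - x0))\<^sup>2) \<and> gauss_barrier x0 \<alpha> \<epsilon> k x1 = v x1 \<longrightarrow>
        \<not> (\<forall>\<^sub>F x in at x1 within \<Omega>. gauss_barrier x0 \<alpha> \<epsilon> k x \<le> v x))"

lemma supersolution_untouched:
  fixes x0 :: "real^'n" and p \<theta> \<sigma> a R M :: real
  assumes "p > 1" "\<theta> > 0" "\<sigma> > \<theta>" "0 < a" "a \<le> R"
    and bounds: "\<And>x. x \<in> \<Omega> \<Longrightarrow> norm (B x) \<le> M \<and> \<bar>\<rho> x\<bar> \<le> M \<and> \<bar>c x\<bar> \<le> M"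
    and "M \<ge> 0"
    and rho: "\<sigma> < 1 + \<theta> \<longrightarrow> (\<forall>x\<in>\<Omega>. \<rho> x \<ge> 0)"
    and nonneg: "\<forall>x\<in>\<Omega>. v x \<ge> 0"
    and super: "viscosity_supersolution p \<theta> \<sigma> B \<rho> c \<Omega> v"
  obtains \<alpha> \<epsilon>0 where "\<alpha> > 0" "\<epsilon>0 > 0"
    "\<And>\<epsilon>. 0 < \<epsilon> \<Longrightarrow> \<epsilon> \<le> \<epsilon>0 \<Longrightarrow> untouched \<Omega> v x0 a R \<alpha> \<epsilon>"
proof -
  obtain \<alpha> \<epsilon>0 where ae: "\<alpha> > 0" "\<epsilon>0 > 0"
    and strict: "\<And>(B :: real^'n \<Rightarrow> real^'n) \<rho> \<epsilon> k x. \<lbrakk>0 < \<epsilon>; \<epsilon> \<le> \<epsilon>0; a \<le> norm (x - x0); norm (x - x0) \<le> R;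
           norm (B x) \<le> M; \<bar>\<rho> x\<bar> \<le> M; \<sigma> < 1 + \<theta> \<longrightarrow> \<rho> x \<ge> 0\<rbrakk> \<Longrightarrow>
         M * (\<epsilon> * exp (- \<alpha> * (norm (x - x0))\<^sup>2)) powr (1 + \<theta>)
         < norm (grad (gauss_barrier x0 \<alpha> \<epsilon> k) x) powr \<theta>
             * normalized_p_laplacian p (gauss_barrier x0 \<alpha> \<epsilon> k) x
           + first_order_term \<theta> \<sigma> B \<rho> (grad (gauss_barrier x0 \<alpha> \<epsilon> k) x) x"
    using gauss_barrier_strict_subsolution[OF assms(1-3) \<open>M \<ge> 0\<close> assms(4,5)] by metis
  have "untouched \<Omega> v x0 a R \<alpha> \<epsilon>" if \<epsilon>: "0 < \<epsilon>" "\<epsilon> \<le> \<epsilon>0" for \<epsilon>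
    unfolding untouched_def
  proof (intro allI ballI impI notI, elim conjE)
    fix k x1
    let ?\<phi> = "gauss_barrier x0 \<alpha> \<epsilon> k"
    let ?E = "\<epsilon> * exp (- \<alpha> * (norm (x1 - x0))\<^sup>2)"
    assume x1: "x1 \<in> \<Omega>" "a \<le> norm (x1 - x0)" "norm (x1 - x0) \<le> R"
      and small: "v x1 \<le> ?E" and eq: "?\<phi> x1 = v x1"
      and touch: "\<forall>\<^sub>F x in at x1 within \<Omega>. ?\<phi> x \<le> v x"
    have g: "grad ?\<phi> x1 \<noteq> 0"
      unfolding grad_gauss_barrier using ae \<epsilon> x1 assms(4) by auto
    have "\<forall>\<^sub>F x in at x1 within \<Omega>. v x1 - ?\<phi> x1 \<le> v x - ?\<phi> x"
      using touch by eventually_elim (simp add: eq)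
    then have "C2_on \<Omega> ?\<phi> \<and> x1 \<in> \<Omega> \<and> ?\<phi> x1 = v x1 \<and>
        (\<forall>\<^sub>F x in at x1 within \<Omega>. v x1 - ?\<phi> x1 \<le> v x - ?\<phi> x)"
      using x1(1) eq C2_on_gauss_barrier by blast
    then have "norm (grad ?\<phi> x1) powr \<theta> * normalized_p_laplacian p ?\<phi> x1
        + first_order_term \<theta> \<sigma> B \<rho> (grad ?\<phi> x1) x1 \<le> zero_order_rhs \<theta> c x1 (v x1)"
      using super[unfolded viscosity_supersolution_def, THEN conjunct2, THEN spec, THEN spec,
          of ?\<phi> x1] g eq by simp
    also have "\<dots> \<le> \<bar>c x1\<bar> * v x1 powr (1 + \<theta>)"
      unfolding zero_order_rhs_def by (intro mult_right_mono) auto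
    also have "\<dots> \<le> M * ?E powr (1 + \<theta>)"
      using bounds[OF x1(1)] nonneg x1(1) small assms(2) by (intro mult_mono powr_mono2) auto
    also have "\<dots> < norm (grad ?\<phi> x1) powr \<theta> * normalized_p_laplacian p ?\<phi> x1
        + first_order_term \<theta> \<sigma> B \<rho> (grad ?\<phi> x1) x1"
      using strict[of \<epsilon> x1 B \<rho> k] \<epsilon> x1 bounds[OF x1(1)] rho by blast
    finally show False by simp
  qed
  then show ?thesis using that ae by blast
qed

text \<open>The outer radius \<open>s\<close>, on whose sphere the barrier vanishes, may be smaller than \<open>R\<close>. No
  condition on \<open>v\<close> is needed on the outer sphere beyond \<open>v \<ge> 0\<close>.\<close>

lemma gauss_barrier_comparison:
  fixes x0 :: "real^'n"
  assumes cont: "continuous_on \<Omega> v" and nonneg: "\<forall>x\<in>\<Omega>. v x \<ge> 0"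
    and untouched: "untouched \<Omega> v x0 a R \<alpha> \<epsilon>" and "\<alpha> > 0" "\<epsilon> > 0"
    and "s \<le> R" and sub: "cball x0 s \<subseteq> \<Omega>"
    and inner: "\<And>x. norm (x - x0) = a \<Longrightarrow> x \<in> \<Omega> \<Longrightarrow> \<epsilon> \<le> v x"
    and x: "a \<le> norm (x - x0)" "norm (x - x0) \<le> s"
  shows "gauss_barrier x0 \<alpha> \<epsilon> (- \<epsilon> * exp (- \<alpha> * s\<^sup>2)) x \<le> v x"
proof -
  let ?w = "gauss_barrier x0 \<alpha> \<epsilon> (- \<epsilon> * exp (- \<alpha> * s\<^sup>2))"
  define A where "A = cball x0 s - ball x0 a"
  have memA: "y \<in> A \<longleftrightarrow> a \<le> norm (y - x0) \<and> norm (y - x0) \<le> s" for y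
    unfolding A_def by (auto simp: dist_norm norm_minus_commute)
  have "compact A" unfolding A_def by (simp add: compact_diff)
  moreover have "A \<noteq> {}" using x memA by blast
  moreover have "continuous_on A (\<lambda>y. v y - ?w y)"
    unfolding gauss_barrier_def using sub A_def
    by (intro continuous_intros continuous_on_subset[OF cont]) auto
  ultimately obtain x1 where x1: "x1 \<in> A" and min: "\<And>y. y \<in> A \<Longrightarrow> v x1 - ?w x1 \<le> v y - ?w y"
    using continuous_attains_inf[of A "\<lambda>y. v y - ?w y"] by blast
  have x1O: "x1 \<in> \<Omega>" using x1 sub A_def by auto
  have "v x1 - ?w x1 \<ge> 0"
  proof (rule ccontr)
    assume "\<not> ?thesis"
    then have neg: "v x1 < ?w x1" by simp
    have w_less: "?w x1 < \<epsilon> * exp (- \<alpha> * (norm (x1 - x0))\<^sup>2)"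
      unfolding gauss_barrier_def using \<open>\<epsilon> > 0\<close> by simp
    have "\<epsilon> * exp (- \<alpha> * (norm (x1 - x0))\<^sup>2) \<le> \<epsilon> * 1"
      using \<open>\<alpha> > 0\<close> \<open>\<epsilon> > 0\<close> by (intro mult_left_mono) auto
    then have "norm (x1 - x0) \<noteq> a" using inner[OF _ x1O] neg w_less by auto
    moreover have "norm (x1 - x0) \<noteq> s"
    proof
      assume "norm (x1 - x0) = s"
      then have "?w x1 = 0" unfolding gauss_barrier_def by simp
      then show False using neg nonneg x1O by fastforce
    qed
    ultimately have d: "a < norm (x1 - x0)" "norm (x1 - x0) < s" using x1 memA[of x1] by auto
    have "open (ball x0 s - cball x0 a)" by (simp add: open_Diff)
    moreover have "x1 \<in> ball x0 s - cball x0 a"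
      using d by (auto simp: dist_norm norm_minus_commute)
    ultimately have ev: "\<forall>\<^sub>F y in at x1 within \<Omega>. y \<in> ball x0 s - cball x0 a"
      unfolding eventually_at_topological by blast
    \<comment> \<open>Shift the barrier by the negative minimum, so that it touches \<open>v\<close> at \<open>x1\<close>.\<close>
    let ?k = "- \<epsilon> * exp (- \<alpha> * s\<^sup>2) + (v x1 - ?w x1)"
    have shift: "gauss_barrier x0 \<alpha> \<epsilon> ?k y = ?w y + (v x1 - ?w x1)" for y
      unfolding gauss_barrier_def by simp
    have "\<forall>\<^sub>F y in at x1 within \<Omega>. gauss_barrier x0 \<alpha> \<epsilon> ?k y \<le> v y"
      using ev
    proof eventually_elim
      case (elim y)
      then have "y \<in> A" unfolding A_def by auto
      from min[OF this] show ?case unfolding shift by simp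
    qed
    moreover have "gauss_barrier x0 \<alpha> \<epsilon> ?k x1 = v x1" unfolding shift by simp
    ultimately show False
      using untouched x1O d neg w_less \<open>s \<le> R\<close> unfolding untouched_def
      by (meson less_imp_le less_trans order_trans)
  qed
  moreover have "x \<in> A" using x memA by simp
  ultimately show ?thesis using min[of x] by linarith
qed

section \<open>Strong maximum principle and boundary estimate\<close>

lemma positive_lower_bound_cball:
  fixes x0 :: "real^'n"
  assumes "continuous_on \<Omega> v" "cball x0 a \<subseteq> \<Omega>" "0 \<le> a" "\<And>x. x \<in> cball x0 a \<Longrightarrow> (v x :: real) > 0"
  obtains m where "m > 0" "\<And>x. x \<in> cball x0 a \<Longrightarrow> m \<le> v x"
proof -
  have "continuous_on (cball x0 a) v" using assms continuous_on_subset by blast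
  then obtain y where "y \<in> cball x0 a" "\<And>x. x \<in> cball x0 a \<Longrightarrow> v y \<le> v x"
    using continuous_attains_inf[of "cball x0 a" v] assms(3) by auto
  then show ?thesis using that assms(4) by blast
qed

text \<open>By connectedness some zero \<open>z1\<close> of \<open>v\<close> is a limit of points where \<open>v > 0\<close>. Such a point,
  closer to \<open>z1\<close> than to the complement of \<open>\<Omega>\<close>, is the centre of the ball, whose radius is
  its distance to the zero set.\<close>

lemma ball_touching_zero_set:
  fixes \<Omega> :: "(real^'n) set"
  assumes "open \<Omega>" "connected \<Omega>" and cont: "continuous_on \<Omega> v" and nonneg: "\<forall>x\<in>\<Omega>. v x \<ge> (0::real)"
    and "\<not> (\<forall>x\<in>\<Omega>. v x = 0)" "\<not> (\<forall>x\<in>\<Omega>. v x > 0)"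
  obtains x0 z where "z \<noteq> x0" "cball x0 (dist x0 z) \<subseteq> \<Omega>" "v z = 0"
    "\<And>x. x \<in> ball x0 (dist x0 z) \<Longrightarrow> v x > 0"
proof -
  define Z where "Z = {x \<in> \<Omega>. v x = 0}"
  have Zne: "Z \<noteq> {}" using assms(6) nonneg unfolding Z_def by (auto simp: less_le)
  have Zn\<Omega>: "Z \<noteq> \<Omega>" using assms(5) unfolding Z_def by auto
  have "closedin (top_of_set \<Omega>) Z"
    unfolding Z_def by (rule continuous_closedin_preimage_constant[OF cont])
  then have "\<not> openin (top_of_set \<Omega>) Z"
    using \<open>connected \<Omega>\<close> Zne Zn\<Omega> unfolding connected_clopen by blast
  then have "\<not> open Z" using openin_open_eq[OF \<open>open \<Omega>\<close>] by (auto simp: Z_def)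
  then obtain z1 where z1: "z1 \<in> Z" "\<And>e. e > 0 \<Longrightarrow> \<not> ball z1 e \<subseteq> Z"
    unfolding open_contains_ball by blast
  then obtain e where e: "e > 0" "ball z1 e \<subseteq> \<Omega>"
    using \<open>open \<Omega>\<close> unfolding open_contains_ball Z_def by blast
  then obtain y where y: "y \<in> ball z1 (e/2)" "y \<notin> Z" using z1(2)[of "e/2"] by (meson half_gt_zero subsetI)
  define K where "K = {x \<in> cball y (dist y z1). v x = 0}"
  have cb: "cball y (dist y z1) \<subseteq> \<Omega>"
  proof
    fix u assume "u \<in> cball y (dist y z1)"
    then have "dist z1 u < e"
      using y dist_triangle[of z1 u y] by (simp add: dist_commute)
    then show "u \<in> \<Omega>" using e by auto
  qed
  have "closed K" unfolding K_def
    using continuous_closed_preimage_constant[of "cball y (dist y z1)" v 0]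
      continuous_on_subset[OF cont cb] by simp
  moreover have "z1 \<in> K" using z1 unfolding K_def Z_def by simp
  ultimately obtain z where z: "z \<in> K" "\<And>u. u \<in> K \<Longrightarrow> dist y z \<le> dist y u"
    using distance_attains_inf[of K y] by blast
  have yz: "dist y z \<le> dist y z1" using z \<open>z1 \<in> K\<close> by blast
  have vz: "v z = 0" "z \<in> \<Omega>" using z cb K_def by auto
  have "z \<noteq> y" using y vz unfolding Z_def by auto
  moreover have "cball y (dist y z) \<subseteq> \<Omega>" using cb yz by (meson order_trans subset_cball)
  moreover have "v x > 0" if "x \<in> ball y (dist y z)" for x
  proof -
    have "x \<in> cball y (dist y z1)" using that yz by auto
    moreover have "x \<notin> K" using z(2)[of x] that by auto
    ultimately show ?thesis using nonneg cb unfolding K_def by (auto simp: less_le)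
  qed
  ultimately show ?thesis using that vz by blast
qed

theorem theorem1p9:
  fixes \<Omega> :: "(real^'n) set"
    and p \<theta> \<sigma> :: real
    and B :: "real^'n \<Rightarrow> real^'n"
    and \<rho> c v :: "real^'n \<Rightarrow> real"
  assumes "open \<Omega>" and "connected \<Omega>" and "\<Omega> \<noteq> {}" and "bounded \<Omega>"
    and "p > 1" and "\<theta> > 0" and "\<sigma> > \<theta>"
    and "continuous_on (closure \<Omega>) B"
    and "continuous_on (closure \<Omega>) \<rho>"
    and "continuous_on (closure \<Omega>) c"
    and "\<forall>x\<in>closure \<Omega>. c x \<le> 0"
    and "locally_Lipschitz_in \<Omega> v"
    and "\<forall>x\<in>\<Omega>. v x \<ge> 0"
    and "viscosity_supersolution p \<theta> \<sigma> B \<rho> c \<Omega> v"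
    and "\<sigma> < 1 + \<theta> \<longrightarrow> (\<forall>x\<in>closure \<Omega>. \<rho> x \<ge> 0)"
  shows "((\<forall>x\<in>\<Omega>. v x = 0) \<or> (\<forall>x\<in>\<Omega>. v x > 0)) \<and>
    (interior_sphere_condition \<Omega> \<longrightarrow>
      (\<forall>z\<in>frontier \<Omega>.
        (\<forall>x\<in>\<Omega>. v x > 0) \<and> (v \<longlongrightarrow> 0) (at z within \<Omega>) \<longrightarrow>
          (\<forall>x0 r. interior_tangent_ball \<Omega> z x0 r \<longrightarrow>
            (\<exists>\<nu>>0. \<forall>x\<in>ball x0 r. v x \<ge> \<nu> * (r - norm (x - x0))))))"
proof -
  have cont: "continuous_on \<Omega> v" using assms(14) unfolding viscosity_supersolution_def by blast
  have comp: "compact (closure \<Omega>)" using assms(4) by (simp add: compact_closure)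
  have "bounded (B ` closure \<Omega>)" "bounded (\<rho> ` closure \<Omega>)" "bounded (c ` closure \<Omega>)"
    using comp assms(8-10) by (auto intro!: compact_imp_bounded compact_continuous_image)
  then obtain M1 M2 M3 where M123: "\<forall>x\<in>closure \<Omega>. norm (B x) \<le> M1" "\<forall>x\<in>closure \<Omega>. norm (\<rho> x) \<le> M2"
    "\<forall>x\<in>closure \<Omega>. norm (c x) \<le> M3"
    unfolding bounded_iff by auto
  define M where "M = Max {0, M1, M2, M3}"
  have "M \<ge> 0" "M \<ge> M1" "M \<ge> M2" "M \<ge> M3" unfolding M_def by auto
  then have bounds: "norm (B x) \<le> M \<and> \<bar>\<rho> x\<bar> \<le> M \<and> \<bar>c x\<bar> \<le> M" if "x \<in> \<Omega>" for x
    using M123 that closure_subset by (fastforce simp: real_norm_def)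
  have rho: "\<sigma> < 1 + \<theta> \<longrightarrow> (\<forall>x\<in>\<Omega>. \<rho> x \<ge> 0)" using assms(15) closure_subset by blast
  note barrier = supersolution_untouched[OF assms(5-7) _ _ bounds \<open>M \<ge> 0\<close> rho assms(13,14)]

  have strong: "(\<forall>x\<in>\<Omega>. v x = 0) \<or> (\<forall>x\<in>\<Omega>. v x > 0)"
  proof (rule ccontr)
    assume "\<not> ?thesis"
    then obtain x0 z where z: "z \<noteq> x0" "cball x0 (dist x0 z) \<subseteq> \<Omega>" "v z = 0"
      and pos: "\<And>x. x \<in> ball x0 (dist x0 z) \<Longrightarrow> v x > 0"
      using ball_touching_zero_set[OF assms(1,2) cont assms(13)] by metis
    define R where "R = dist x0 z"
    have "R > 0" using z by (simp add: R_def)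
    then have sub: "cball x0 (R/2) \<subseteq> \<Omega>" and sub': "cball x0 (R/2) \<subseteq> ball x0 R"
      using z(2) unfolding R_def[symmetric] by auto
    obtain m where m: "m > 0" "\<And>x. x \<in> cball x0 (R/2) \<Longrightarrow> m \<le> v x"
      using positive_lower_bound_cball[OF cont sub, where thesis = thesis] pos[folded R_def] sub' \<open>R > 0\<close>
      by (meson half_gt_zero less_imp_le subsetD)
    obtain \<alpha> \<epsilon>0 where ae: "\<alpha> > 0" "\<epsilon>0 > 0"
      and unt: "\<And>\<epsilon>. 0 < \<epsilon> \<Longrightarrow> \<epsilon> \<le> \<epsilon>0 \<Longrightarrow> untouched \<Omega> v x0 (R/2) R \<alpha> \<epsilon>"
      using barrier[of "R/2" R x0] \<open>R > 0\<close> by auto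
    define \<epsilon> where "\<epsilon> = min m \<epsilon>0"
    have \<epsilon>: "\<epsilon> > 0" "\<epsilon> \<le> m" "\<epsilon> \<le> \<epsilon>0" using m ae by (auto simp: \<epsilon>_def)
    let ?k = "- \<epsilon> * exp (- \<alpha> * R\<^sup>2)"
    let ?w = "gauss_barrier x0 \<alpha> \<epsilon> ?k"
    have below: "?w x \<le> v x" if "x \<in> \<Omega>" "R/2 \<le> norm (x - x0)" for x
    proof (cases "norm (x - x0) \<le> R")
      case True
      show ?thesis
      proof (rule gauss_barrier_comparison[OF cont assms(13) unt[OF \<epsilon>(1,3)] ae(1) \<epsilon>(1) order_refl _ _ that(2) True])
        show "cball x0 R \<subseteq> \<Omega>" using z(2) unfolding R_def .
        show "\<epsilon> \<le> v y" if "norm (y - x0) = R/2" for y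
          using m(2)[of y] that \<epsilon>(2) by (simp add: dist_norm norm_minus_commute)
      qed
    next
      case False
      then have "R\<^sup>2 \<le> (norm (x - x0))\<^sup>2" using \<open>R > 0\<close> by (intro power_mono) auto
      then have "?w x \<le> 0" unfolding gauss_barrier_def using ae \<epsilon> by simp
      then show ?thesis using assms(13) that(1) by fastforce
    qed
    have zR: "norm (z - x0) = R" by (simp add: R_def dist_norm norm_minus_commute)
    have "z \<in> \<Omega>" using z(2) by auto
    have "open (- cball x0 (R/2))" "z \<in> - cball x0 (R/2)"
      using zR \<open>R > 0\<close> by (auto simp: dist_norm norm_minus_commute)
    then have "\<forall>\<^sub>F x in at z within \<Omega>. x \<in> \<Omega> \<and> x \<in> - cball x0 (R/2)"
      by (auto simp: eventually_at_topological)
    then have "\<forall>\<^sub>F x in at z within \<Omega>. ?w x \<le> v x"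
    proof eventually_elim
      case (elim x)
      then show ?case by (intro below) (auto simp: dist_norm norm_minus_commute)
    qed
    moreover have "?w z = v z" unfolding gauss_barrier_def zR z(3) by simp
    ultimately show False
      using unt[OF \<epsilon>(1,3)] \<open>z \<in> \<Omega>\<close> zR z(3) \<epsilon>(1) \<open>R > 0\<close> unfolding untouched_def by force
  qed

  have hopf: "\<exists>\<nu>>0. \<forall>x\<in>ball x0 r. v x \<ge> \<nu> * (r - norm (x - x0))"
    if pos: "\<forall>x\<in>\<Omega>. v x > 0" and ball: "interior_tangent_ball \<Omega> z x0 r" for z x0 r
  proof -
    have "r > 0" and sub: "ball x0 r \<subseteq> \<Omega>" using ball unfolding interior_tangent_ball_def by auto
    have sub2: "cball x0 (r/2) \<subseteq> \<Omega>" using sub \<open>r > 0\<close> by (force simp: subset_iff)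
    obtain m where m: "m > 0" "\<And>x. x \<in> cball x0 (r/2) \<Longrightarrow> m \<le> v x"
      using positive_lower_bound_cball[OF cont sub2, where thesis = thesis] pos sub2 \<open>r > 0\<close>
      by (meson half_gt_zero less_imp_le subsetD)
    obtain \<alpha> \<epsilon>0 where ae: "\<alpha> > 0" "\<epsilon>0 > 0"
      and unt: "\<And>\<epsilon>. 0 < \<epsilon> \<Longrightarrow> \<epsilon> \<le> \<epsilon>0 \<Longrightarrow> untouched \<Omega> v x0 (r/2) r \<alpha> \<epsilon>"
      using barrier[of "r/2" r x0] \<open>r > 0\<close> by auto
    define \<epsilon> where "\<epsilon> = min m \<epsilon>0"
    have \<epsilon>: "\<epsilon> > 0" "\<epsilon> \<le> m" "\<epsilon> \<le> \<epsilon>0" using m ae by (auto simp: \<epsilon>_def)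
    \<comment> \<open>\<open>v\<close> need not extend continuously to the sphere of radius \<open>r\<close>, which may meet the
      frontier in several points; hence the limit \<open>s \<rightarrow> r\<close> from below.\<close>
    have below: "\<epsilon> * (exp (- \<alpha> * (norm (x - x0))\<^sup>2) - exp (- \<alpha> * r\<^sup>2)) \<le> v x"
      if x: "r/2 \<le> norm (x - x0)" "norm (x - x0) < r" for x
    proof (rule tendsto_upperbound)
      show "((\<lambda>s. \<epsilon> * (exp (- \<alpha> * (norm (x - x0))\<^sup>2) - exp (- \<alpha> * s\<^sup>2))) \<longlongrightarrow>
          \<epsilon> * (exp (- \<alpha> * (norm (x - x0))\<^sup>2) - exp (- \<alpha> * r\<^sup>2))) (at_left r)"
        by (intro tendsto_intros)
      have "\<epsilon> * (exp (- \<alpha> * (norm (x - x0))\<^sup>2) - exp (- \<alpha> * s\<^sup>2)) \<le> v x"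
        if s: "norm (x - x0) < s" "s < r" for s
      proof -
        have "gauss_barrier x0 \<alpha> \<epsilon> (- \<epsilon> * exp (- \<alpha> * s\<^sup>2)) x \<le> v x"
        proof (rule gauss_barrier_comparison[OF cont assms(13) unt[OF \<epsilon>(1,3)] ae(1) \<epsilon>(1)])
          show "cball x0 s \<subseteq> \<Omega>" using s sub by (force simp: subset_iff)
          show "\<epsilon> \<le> v y" if "norm (y - x0) = r/2" for y
            using m(2)[of y] that \<epsilon>(2) by (simp add: dist_norm norm_minus_commute)
        qed (use s x in auto)
        then show ?thesis unfolding gauss_barrier_def by (simp add: algebra_simps)
      qed
      then show "\<forall>\<^sub>F s in at_left r. \<epsilon> * (exp (- \<alpha> * (norm (x - x0))\<^sup>2) - exp (- \<alpha> * s\<^sup>2)) \<le> v x"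
        using x(2) by (auto simp: eventually_at_left_field)
    qed auto
    define \<nu> where "\<nu> = min (m / r) (\<epsilon> * exp (- \<alpha> * r\<^sup>2) * \<alpha> * r)"
    have "\<nu> > 0" unfolding \<nu>_def using m \<open>r > 0\<close> \<epsilon> ae by simp
    moreover have "\<nu> * (r - norm (x - x0)) \<le> v x" if "x \<in> ball x0 r" for x
    proof -
      define d where "d = norm (x - x0)"
      have d: "0 \<le> d" "d < r" using that by (auto simp: d_def dist_norm norm_minus_commute)
      show ?thesis
      proof (cases "r/2 \<le> d")
        case True
        \<comment> \<open>Factor out \<open>exp (-\<alpha> r\<^sup>2)\<close>, then use \<open>exp y - 1 \<ge> y\<close> and \<open>r\<^sup>2 - d\<^sup>2 \<ge> r (r - d)\<close>.\<close>
        have "\<nu> * (r - d) \<le> (\<epsilon> * exp (- \<alpha> * r\<^sup>2) * \<alpha> * r) * (r - d)"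
          using d by (intro mult_right_mono) (auto simp: \<nu>_def)
        also have "\<dots> = \<epsilon> * exp (- \<alpha> * r\<^sup>2) * (\<alpha> * (r * (r - d)))" by simp
        also have "\<dots> \<le> \<epsilon> * exp (- \<alpha> * r\<^sup>2) * (exp (\<alpha> * (r\<^sup>2 - d\<^sup>2)) - 1)"
        proof (intro mult_left_mono)
          have "r * (r - d) \<le> (r + d) * (r - d)" using d by (intro mult_right_mono) auto
          also have "\<dots> = r\<^sup>2 - d\<^sup>2" by (simp add: algebra_simps power2_eq_square)
          finally have "\<alpha> * (r * (r - d)) \<le> \<alpha> * (r\<^sup>2 - d\<^sup>2)" using ae by simp
          then show "\<alpha> * (r * (r - d)) \<le> exp (\<alpha> * (r\<^sup>2 - d\<^sup>2)) - 1"
            using exp_ge_add_one_self[of "\<alpha> * (r\<^sup>2 - d\<^sup>2)"] by linarith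
        qed (use \<epsilon> in auto)
        also have "\<dots> = \<epsilon> * (exp (- \<alpha> * d\<^sup>2) - exp (- \<alpha> * r\<^sup>2))"
          by (simp add: algebra_simps exp_add[symmetric])
        also have "\<dots> \<le> v x" using below[of x] True d unfolding d_def by simp
        finally show ?thesis unfolding d_def .
      next
        case False
        have "\<nu> * (r - d) \<le> (m / r) * r"
          using d m \<open>r > 0\<close> by (intro mult_mono) (auto simp: \<nu>_def)
        also have "\<dots> = m" using \<open>r > 0\<close> by simp
        also have "\<dots> \<le> v x" using False m(2)[of x]
          by (simp add: d_def dist_norm norm_minus_commute)
        finally show ?thesis unfolding d_def .
      qed
    qed
    ultimately show ?thesis by blast
  qed
  show ?thesis using strong hopf by blast
qed

end
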